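(* Let $d\ge 1$ and let $P\subset\mathbb{R}^d$ be a convex polytope with vertices in $\mathbb{Z}^d$. Suppose that $P$ multi-tiles $\mathbb{R}^d$ under the group $\mathcal{G}$, i.e. there is an integer $m$ such that $\sum_{g\in\mathcal{G}}1_P(gx)=m$ for almost every $x\in\mathbb{R}^d$. Then for every positive integer $n$, \[G_P(n)=\operatorname{vol}(P)\,G(n)^d .\]
   Context: $\mathcal{W}$ denotes the finite group of linear maps of $\mathbb{R}^d$ generated by the reflections in the coordinate hyperplanes and all permutations of the coordinates (so $|\mathcal{W}|=2^d d!$), and $\mathcal{G}$ is the group of maps of $\mathbb{R}^d$ generated by $\mathcal{W}$ and all translations by vectors of $\mathbb{Z}^d$. $1_P$ is the indicator function of $P$. For $x\in\mathbb{R}^d$, the solid angle $\omega_P(x)$ is $\operatorname{vol}(B(x,r)\cap P)/\operatorname{vol}(B(x,r))$ for all sufficiently small $r>0$ (so it is $1$ in the interior of $P$, $0$ outside $P$). Write $e(t)=e^{2\pi i t}$. The polyhedral Gauss sum is $G_P(n)=\sum_{x\in\mathbb{Z}^d}\omega_{nP}(x)\,e(\|x\|^2/n)$, where $nP$ is the dilate of $P$ by $n$, and $G(n)=\sum_{k\in\mathbb{Z}/n\mathbb{Z}}e(k^2/n)$ is the classical Gauss sum. *)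

theory Defs
  imports "HOL-Analysis.Analysis"
begin

definition int_lattice :: "(real^'d) set" where
  "int_lattice = {x. \<forall>i. x $ i \<in> \<int>}"

definition hyperoct :: "((real^'d) \<Rightarrow> (real^'d)) set" where
  "hyperoct = {(\<lambda>x. \<chi> i. s i * x $ (\<pi> i)) | s \<pi>.
       \<pi> permutes (UNIV :: 'd set) \<and> (\<forall>i. s i = 1 \<or> s i = -1)}"

definition affine_group :: "((real^'d) \<Rightarrow> (real^'d)) set" where
  "affine_group = {(\<lambda>x. w x + t) | w t. w \<in> hyperoct \<and> t \<in> int_lattice}"

text \<open>Solid angle of P at x: the (eventually constant) value of the relative
  volume of small balls around x.\<close>
definition solid_angle :: "(real^'d) set \<Rightarrow> real^'d \<Rightarrow> real" where
  "solid_angle P x = Lim (at_right 0)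
     (\<lambda>r. measure lebesgue (ball x r \<inter> P) / measure lebesgue (ball x r))"

definition ee :: "real \<Rightarrow> complex" where
  "ee t = exp (2 * pi * \<i> * complex_of_real t)"

definition poly_gauss_sum :: "(real^'d) set \<Rightarrow> nat \<Rightarrow> complex" where
  "poly_gauss_sum P n = infsum (\<lambda>x. complex_of_real (solid_angle ((\<lambda>y. real n *\<^sub>R y) ` P) x)
        * ee ((norm x)\<^sup>2 / real n)) int_lattice"

definition gauss_sum :: "nat \<Rightarrow> complex" where
  "gauss_sum n = (\<Sum>k<n. ee (real (k\<^sup>2) / real n))"

end

theory Submission
  imports Defs
begin

text \<open>
  Write \<open>\<omega>\<close> for the solid angle of \<open>P\<close>, \<open>W\<close> for the hyperoctahedral group and \<open>L\<close> for the integer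
  lattice. Averaging the multi-tiling identity over small balls around \<open>x\<close> upgrades it from almost
  every point to every point: \<open>\<Sum>w\<in>W. \<Sum>t\<in>L. \<omega> (w x + t) = m\<close>. Averaging it over a unit
  cube gives \<open>m = card W * vol P\<close>. On \<open>L\<close> the summand \<open>f x = ee (\<bar>x\<bar>^2 / n)\<close> is invariant under
  \<open>W\<close> and under translation by \<open>n L\<close>. Writing lattice points as \<open>q + n t\<close> with \<open>q\<close> in the
  box \<open>[0, n)\<close> in each coordinate and averaging over \<open>W\<close> therefore gives
  \<open>card W * G_P(n) = m * (\<Sum>q. f q)\<close>, and the last sum factors as \<open>G(n)^d\<close>.
\<close>

section \<open>The hyperoctahedral group and its action on the integer lattice\<close>

lemma hyperoctE:
  assumes "w \<in> hyperoct"
  obtains s \<pi> where "w = (\<lambda>x. \<chi> i. s i * x $ (\<pi> i))" "\<pi> permutes UNIV" "\<And>i. s i = 1 \<or> s i = -1"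
  using assms unfolding hyperoct_def by blast

lemma hyperoct_linear: "w \<in> hyperoct \<Longrightarrow> linear w"
  by (elim hyperoctE) (auto intro!: linearI simp: vec_eq_iff algebra_simps)

lemma hyperoct_norm:
  assumes "w \<in> hyperoct"
  shows "norm (w x) = norm x"
proof -
  obtain s \<pi> where w: "w = (\<lambda>x. \<chi> i. s i * x $ (\<pi> i))" and p: "\<pi> permutes UNIV"
    and s: "\<And>i. s i = 1 \<or> s i = -1"
    using hyperoctE[OF assms] by blast
  have sq: "(s i)\<^sup>2 = 1" for i
    using s[of i] by auto
  have "(\<Sum>i\<in>UNIV. (w x $ i)\<^sup>2) = (\<Sum>i\<in>UNIV. (x $ \<pi> i)\<^sup>2)"
    by (simp add: w power_mult_distrib sq)
  also have "\<dots> = (\<Sum>i\<in>UNIV. (x $ i)\<^sup>2)"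
    using sum.permute[OF p, of "\<lambda>i. (x $ i)\<^sup>2"] by (simp add: o_def)
  finally show ?thesis
    by (simp add: norm_vec_def L2_set_def)
qed

lemma hyperoct_orthogonal: "w \<in> hyperoct \<Longrightarrow> orthogonal_transformation w"
  by (simp add: orthogonal_transformation hyperoct_linear hyperoct_norm)

lemma hyperoct_bij: "w \<in> hyperoct \<Longrightarrow> bij w"
  by (simp add: hyperoct_orthogonal orthogonal_transformation_bij)

lemma hyperoct_mem_lattice_iff:
  assumes "w \<in> hyperoct"
  shows "w x \<in> int_lattice \<longleftrightarrow> x \<in> int_lattice"
proof -
  obtain s \<pi> where w: "w = (\<lambda>x. \<chi> i. s i * x $ (\<pi> i))" and p: "\<pi> permutes UNIV"
    and s: "\<And>i. s i = 1 \<or> s i = -1"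
    using hyperoctE[OF assms] by blast
  have "s i * y \<in> \<int> \<longleftrightarrow> y \<in> \<int>" for i and y :: real
    using s[of i] by auto
  then have "w x \<in> int_lattice \<longleftrightarrow> (\<forall>i. x $ \<pi> i \<in> \<int>)"
    by (simp add: w int_lattice_def)
  also have "\<dots> \<longleftrightarrow> (\<forall>i. x $ i \<in> \<int>)"
    by (metis p permutes_univ)
  finally show ?thesis
    by (simp add: int_lattice_def)
qed

text \<open>Allows lattice sums to be reindexed by \<open>w\<close>, and translations to be pulled
  back through \<open>w\<close>.\<close>

lemma hyperoct_bij_lattice:
  assumes "w \<in> hyperoct"
  shows "bij_betw w int_lattice int_lattice"
proof -
  have "w ` int_lattice = int_lattice"
    using hyperoct_mem_lattice_iff[OF assms] hyperoct_bij[OF assms]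
    by (auto simp: image_iff) (metis bij_pointE)
  then show ?thesis
    using hyperoct_bij[OF assms] by (metis bij_betw_def bij_betw_subset subset_UNIV)
qed

lemma finite_hyperoct: "finite (hyperoct :: ((real^'d) \<Rightarrow> (real^'d)) set)"
proof -
  have "hyperoct \<subseteq> (\<lambda>(s,\<pi>). (\<lambda>x::real^'d. \<chi> i. s i * x $ (\<pi> i))) `
      ((\<Pi>\<^sub>E i\<in>UNIV. {1,-1}) \<times> {\<pi>. \<pi> permutes UNIV})"
    by (auto simp: hyperoct_def image_iff)
  then show ?thesis
    by (rule finite_subset) (auto intro!: finite_imageI finite_PiE finite_permutations)
qed

lemma id_in_hyperoct: "(\<lambda>x. x) \<in> hyperoct"
  unfolding hyperoct_def
  by (rule CollectI, rule exI[of _ "\<lambda>_. 1"], rule exI[of _ id]) (simp add: permutes_id)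

lemma int_lattice_add: "x \<in> int_lattice \<Longrightarrow> y \<in> int_lattice \<Longrightarrow> x + y \<in> int_lattice"
  and int_lattice_diff: "x \<in> int_lattice \<Longrightarrow> y \<in> int_lattice \<Longrightarrow> x - y \<in> int_lattice"
  and int_lattice_scaleR: "x \<in> int_lattice \<Longrightarrow> real n *\<^sub>R x \<in> int_lattice"
  by (auto simp: int_lattice_def)

section \<open>Invariance of Lebesgue measure under signed permutations\<close>

lemma hyperoct_borel_measurable: "w \<in> hyperoct \<Longrightarrow> w \<in> borel_measurable borel"
  using hyperoct_linear linear_continuous_on linear_conv_bounded_linear
  by (intro borel_measurable_continuous_onI) blast

text \<open>Lebesgue measure is determined by its values on open boxes. The preimage of a box under
  a signed permutation is again a box, whose side lengths are a permutation of the original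
  ones.\<close>

lemma hyperoct_distr_lborel:
  fixes w :: "real^'d \<Rightarrow> real^'d"
  assumes "w \<in> hyperoct"
  shows "distr lborel borel w = lborel"
proof -
  obtain s \<pi> where w: "w = (\<lambda>x. \<chi> i. s i * x $ (\<pi> i))" and p: "\<pi> permutes UNIV"
    and s: "\<And>i. s i = 1 \<or> s i = -1"
    using hyperoctE[OF assms] by blast
  note meas = hyperoct_borel_measurable[OF assms]
  have "lborel = distr lborel borel w"
  proof (rule lborel_eqI)
    fix l u :: "real^'d" assume lu: "\<And>b. b \<in> Basis \<Longrightarrow> l \<bullet> b \<le> u \<bullet> b"
    then have le: "l $ i \<le> u $ i" for i
      by (metis axis_in_Basis_iff cart_eq_inner_axis real_inner_1_right insert_iff Basis_real_def)
    define \<rho> where "\<rho> = inv \<pi>"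
    \<comment> \<open>A coordinate with sign -1 reflects its interval, so the two endpoints swap and
      change sign. The inverse \<open>\<rho>\<close> appears because coordinate \<open>j\<close> of
      \<open>x\<close> is read by coordinate \<open>\<rho> j\<close> of \<open>w x\<close>.\<close>
    define l' u' :: "real^'d" where "l' = (\<chi> j. if s (\<rho> j) = 1 then l $ \<rho> j else - u $ \<rho> j)"
      and "u' = (\<chi> j. if s (\<rho> j) = 1 then u $ \<rho> j else - l $ \<rho> j)"
    have \<rho>: "\<rho> permutes UNIV" "\<rho> (\<pi> i) = i" "\<pi> (\<rho> i) = i" for i
      using p by (auto simp: \<rho>_def permutes_inv permutes_inverses)
    have comp: "l $ i < w x $ i \<and> w x $ i < u $ i \<longleftrightarrow> l' $ \<pi> i < x $ \<pi> i \<and> x $ \<pi> i < u' $ \<pi> i" for x i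
      using s[of i] by (auto simp: w l'_def u'_def \<rho>)
    have "w -` box l u = box l' u'"
    proof (intro set_eqI)
      fix x
      have "x \<in> w -` box l u \<longleftrightarrow> (\<forall>i. l' $ \<pi> i < x $ \<pi> i \<and> x $ \<pi> i < u' $ \<pi> i)"
        by (simp only: vimage_eq mem_box_cart comp)
      also have "\<dots> \<longleftrightarrow> x \<in> box l' u'"
        by (metis \<rho>(3) mem_box_cart)
      finally show "x \<in> w -` box l u \<longleftrightarrow> x \<in> box l' u'" .
    qed
    then have "emeasure (distr lborel borel w) (box l u) = emeasure lborel (box l' u')"
      using meas by (simp add: emeasure_distr)
    also have "\<dots> = ennreal (measure lborel (cbox l' u'))"
    proof -
      have "emeasure lborel (box l' u') = emeasure lborel (cbox l' u')"
        by (simp add: emeasure_lborel_box_eq emeasure_lborel_cbox_eq)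
      then show ?thesis
        using emeasure_lborel_cbox_finite[of l' u'] by (simp add: emeasure_eq_ennreal_measure)
    qed
    also have "measure lborel (cbox l' u') = (\<Prod>j\<in>UNIV. u $ \<rho> j - l $ \<rho> j)"
    proof -
      have "cbox l' u' \<noteq> {}"
        using le by (auto simp: interval_ne_empty_cart l'_def u'_def)
      moreover have "u' $ j - l' $ j = u $ \<rho> j - l $ \<rho> j" for j
        by (simp add: l'_def u'_def)
      ultimately show ?thesis by (simp add: content_cbox_cart)
    qed
    also have "\<dots> = (\<Prod>j\<in>UNIV. u $ j - l $ j)"
      using prod.permute[OF \<rho>(1), of "\<lambda>j. u $ j - l $ j"] by (simp add: o_def)
    also have "\<dots> = measure lborel (cbox l u)"
      using le by (subst content_cbox_cart) (auto simp: interval_ne_empty_cart)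
    also have "\<dots> = (\<Prod>b\<in>Basis. (u - l) \<bullet> b)"
      using lu by (subst content_cbox) (simp_all add: inner_diff_left)
    finally show "emeasure (distr lborel borel w) (box l u) = ennreal (\<Prod>b\<in>Basis. (u - l) \<bullet> b)" .
  qed simp
  then show ?thesis by simp
qed

lemma hyperoct_image_borel:
  fixes w :: "real^'d \<Rightarrow> real^'d"
  assumes w: "w \<in> hyperoct" and C: "C \<in> sets borel"
  shows "w ` C \<in> sets borel"
proof -
  have "linear (inv w)"
    using orthogonal_transformation_inv[OF hyperoct_orthogonal[OF w]]
    by (rule orthogonal_transformation_linear)
  then have "inv w \<in> borel_measurable borel"
    using linear_continuous_on linear_conv_bounded_linear
    by (intro borel_measurable_continuous_onI) blast
  then have "inv w -` C \<inter> space borel \<in> sets borel"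
    using C by (rule measurable_sets)
  then show ?thesis
    using hyperoct_bij[OF w] by (simp add: bij_vimage_eq_inv_image bij_imp_bij_inv inv_inv_eq)
qed

text \<open>Injectivity turns the statement about preimages under \<open>w\<close> into one about
  images. Borel sets suffice for the small balls and the cube to which it is applied after
  intersecting with preimages of \<open>P\<close>.\<close>

lemma hyperoct_image_measure:
  fixes w :: "real^'d \<Rightarrow> real^'d"
  assumes w: "w \<in> hyperoct" and C: "C \<in> sets borel"
  shows "measure lebesgue (w ` C) = measure lebesgue C"
proof -
  note meas = hyperoct_borel_measurable[OF w]
  have "w -` w ` C = C"
    using hyperoct_bij[OF w] by (simp add: bij_is_inj inj_vimage_image_eq)
  then have "measure (distr lborel borel w) (w ` C) = measure lborel C"
    using meas hyperoct_image_borel[OF w C] by (simp add: measure_distr)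
  then show ?thesis
    using hyperoct_distr_lborel[OF w] hyperoct_image_borel[OF w C] C by simp
qed

section \<open>Truncating and integrating the multi-tiling sum\<close>

text \<open>As \<open>P\<close> is bounded, only lattice vectors of bounded length matter near a
  given point; this makes the infinite sums finite.\<close>

lemma finite_lattice_bounded: "finite {t \<in> (int_lattice :: (real^'d) set). norm t \<le> R}"
proof -
  let ?I = "of_int ` {-\<lceil>R\<rceil>..\<lceil>R\<rceil>} :: real set"
  have "{t \<in> (int_lattice :: (real^'d) set). norm t \<le> R} \<subseteq> vec_lambda ` (\<Pi>\<^sub>E i\<in>UNIV. ?I)"
  proof clarify
    fix t :: "real^'d" assume t: "t \<in> int_lattice" "norm t \<le> R"
    have "t $ i \<in> ?I" for i
    proof -
      obtain k where k: "t $ i = of_int k"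
        using t(1) by (auto simp: int_lattice_def elim: Ints_cases)
      have "\<bar>real_of_int k\<bar> \<le> R"
        using component_le_norm_cart[of t i] t(2) k by simp
      then have "-\<lceil>R\<rceil> \<le> k" "k \<le> \<lceil>R\<rceil>" by linarith+
      then show ?thesis using k by auto
    qed
    then show "t \<in> vec_lambda ` (\<Pi>\<^sub>E i\<in>UNIV. ?I)"
      by (intro image_eqI[of _ _ "vec_nth t"]) auto
  qed
  then show ?thesis
    by (rule finite_subset) (auto intro!: finite_imageI finite_PiE)
qed

text \<open>The value at 0 recovers the translation and hence the linear part, so a sum over the set
  of maps counts each pair exactly once.\<close>

lemma affine_group_bij:
  "bij_betw (\<lambda>(w,t). \<lambda>x. w x + t) (hyperoct \<times> int_lattice) affine_group"
proof (rule bij_betw_imageI)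
  show "inj_on (\<lambda>(w,t). \<lambda>x. w x + t) (hyperoct \<times> int_lattice)"
  proof (rule inj_onI, clarify)
    fix w w' :: "real^'d \<Rightarrow> real^'d" and t t'
    assume "w \<in> hyperoct" "w' \<in> hyperoct" and eq: "(\<lambda>x. w x + t) = (\<lambda>x. w' x + t')"
    then have "w 0 = 0" "w' 0 = 0"
      by (simp_all add: hyperoct_linear linear_0)
    then have "t = t'"
      using fun_cong[OF eq, of 0] by simp
    then show "w = w' \<and> t = t'"
      using eq by (auto simp: fun_eq_iff)
  qed
qed (force simp: affine_group_def)

text \<open>Since \<open>w\<close> preserves norms, the triangle inequality gives one cutoff
  \<open>a + b\<close> that serves all \<open>w\<close> and all \<open>x\<close> of norm at most
  \<open>b\<close>.\<close>

lemma hyperoct_translate_notin: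
  assumes "P \<subseteq> cball 0 a" "norm x \<le> b" and "w \<in> hyperoct" "\<not> norm t \<le> a + b"
  shows "w x + t \<notin> P"
proof
  assume "w x + t \<in> P"
  then have "norm (w x + t) \<le> a" using assms(1) by auto
  moreover have "norm t \<le> norm (w x + t) + norm (w x)"
    by (metis add_diff_cancel_left' norm_triangle_ineq4)
  ultimately show False
    using assms(2-4) hyperoct_norm[of w x] by simp
qed

text \<open>The finite index set is the same for every \<open>x\<close> of norm at most
  \<open>b\<close>, so this sum can be integrated term by term over a bounded set.\<close>

lemma infsum_affine_group:
  fixes P :: "(real^'d) set"
  assumes "P \<subseteq> cball 0 a" and "norm x \<le> b"
  shows "(\<Sum>\<^sub>\<infinity>g\<in>affine_group. indicator P (g x) :: real) =
    (\<Sum>w\<in>hyperoct. \<Sum>t | t \<in> int_lattice \<and> norm t \<le> a + b. indicator P (w x + t))"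
proof -
  let ?T = "{t \<in> (int_lattice :: (real^'d) set). norm t \<le> a + b}"
  note out = hyperoct_translate_notin[OF assms]
  have "(\<Sum>\<^sub>\<infinity>g\<in>affine_group. indicator P (g x) :: real) =
      (\<Sum>\<^sub>\<infinity>(w,t)\<in>hyperoct \<times> int_lattice. indicator P (w x + t))"
    by (subst infsum_reindex_bij_betw[OF affine_group_bij, symmetric]) (simp add: case_prod_unfold)
  also have "\<dots> = (\<Sum>\<^sub>\<infinity>(w,t)\<in>hyperoct \<times> ?T. indicator P (w x + t))"
    using out by (intro infsum_cong_neutral) (fastforce simp: indicator_def)+
  also have "\<dots> = (\<Sum>(w,t)\<in>hyperoct \<times> ?T. indicator P (w x + t))"
    using finite_hyperoct finite_lattice_bounded by (intro infsum_finite) blast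
  finally show ?thesis
    by (simp add: sum.cartesian_product)
qed

text \<open>This is the tiling identity integrated over \<open>B\<close>: each \<open>g\<close>
  contributes the volume of the part of \<open>B\<close> that it sends into \<open>P\<close>, which
  equals the volume of \<open>g B\<close> inside \<open>P\<close>. It is used for small balls and
  for the unit cube.\<close>

lemma measure_multitiling:
  fixes P B :: "(real^'d) set" and m :: real
  assumes P: "compact P" "P \<subseteq> cball 0 a"
    and B: "B \<in> sets borel" "B \<subseteq> cball 0 b"
    and tile: "AE x in lborel. (\<Sum>\<^sub>\<infinity>g\<in>affine_group. indicator P (g x) :: real) = m"
  shows "(\<Sum>w\<in>hyperoct. \<Sum>t | t \<in> int_lattice \<and> norm t \<le> a + b.
            measure lebesgue ((\<lambda>x. w x + t) ` B \<inter> P)) = m * measure lebesgue B"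
proof -
  let ?T = "{t \<in> (int_lattice :: (real^'d) set). norm t \<le> a + b}"
  let ?C = "\<lambda>w t. B \<inter> (\<lambda>x. w x + t) -` P"
  have Bm: "B \<in> lmeasurable"
    using B by (intro fmeasurableI2[OF lmeasurable_cball]) auto
  have meas: "?C w t \<in> lmeasurable"
    and eq: "measure lebesgue ((\<lambda>x. w x + t) ` B \<inter> P) = measure lebesgue (?C w t)"
    if w: "w \<in> hyperoct" for w and t :: "real^'d"
  proof -
    have "continuous_on UNIV (\<lambda>x. w x + t)"
      by (intro continuous_intros linear_continuous_on linear_conv_bounded_linear[THEN iffD1]
          hyperoct_linear w)
    then have "closed ((\<lambda>x. w x + t) -` P)"
      using P(1) compact_imp_closed continuous_closed_vimage
      by (metis continuous_on_eq_continuous_within UNIV_I)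
    then have cl: "(\<lambda>x. w x + t) -` P \<in> sets borel"
      by (rule borel_closed)
    then show "?C w t \<in> lmeasurable"
      using Bm by (intro fmeasurable_Int_fmeasurable) auto
    have C: "?C w t \<in> sets borel"
      using B(1) cl by (rule sets.Int)
    \<comment> \<open>Integration produces the pulled-back set, while the conclusion speaks of the
      moved set; the measure-preserving map \<open>w x + t\<close> carries one onto the
      other.\<close>
    have "(\<lambda>x. w x + t) ` B \<inter> P = (\<lambda>x. w x + t) ` ?C w t"
      by blast
    also have "\<dots> = (+) t ` w ` ?C w t"
      by (simp add: image_image add.commute)
    finally show "measure lebesgue ((\<lambda>x. w x + t) ` B \<inter> P) = measure lebesgue (?C w t)"
      using hyperoct_image_measure[OF w C] measure_translation by metis
  qed
  have "(\<Sum>w\<in>hyperoct. \<Sum>t\<in>?T. measure lebesgue ((\<lambda>x. w x + t) ` B \<inter> P)) =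
      (\<Sum>w\<in>hyperoct. \<Sum>t\<in>?T. integral\<^sup>L lebesgue (indicat_real (?C w t)))"
    by (intro sum.cong) (auto simp: eq)
  also have "\<dots> = integral\<^sup>L lebesgue (\<lambda>x. \<Sum>w\<in>hyperoct. \<Sum>t\<in>?T. indicat_real (?C w t) x)"
    using meas by (subst Bochner_Integration.integral_sum; simp add: lmeasurable_iff_integrable)
  also have "\<dots> = integral\<^sup>L lebesgue (\<lambda>x. m * indicator B x)"
  proof (rule integral_cong_AE)
    show "(\<lambda>x. \<Sum>w\<in>hyperoct. \<Sum>t\<in>?T. indicat_real (?C w t) x) \<in> borel_measurable lebesgue"
      using meas by (intro borel_measurable_sum borel_measurable_indicator) auto
    show "(\<lambda>x. m * indicator B x) \<in> borel_measurable lebesgue"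
      using Bm by (intro borel_measurable_times borel_measurable_indicator) auto
    have "AE x in lebesgue. (\<Sum>\<^sub>\<infinity>g\<in>affine_group. indicator P (g x) :: real) = m"
      using tile by (rule AE_completion)
    then show "AE x in lebesgue. (\<Sum>w\<in>hyperoct. \<Sum>t\<in>?T. indicat_real (?C w t) x) = m * indicator B x"
    proof eventually_elim
      case (elim x)
      show ?case
      proof (cases "x \<in> B")
        case True
        then have "norm x \<le> b" using B(2) by auto
        then show ?thesis
          using elim True infsum_affine_group[OF P(2)] by (simp add: indicator_def)
      qed (simp add: indicator_def)
    qed
  qed
  also have "\<dots> = m * measure lebesgue B"
    by simp
  finally show ?thesis .
qed

section \<open>Solid angles and the pointwise tiling identity\<close>

text \<open>By convexity the ratio is nonincreasing in the radius at points of P, so the limit exists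
  without any appeal to the local cone structure of a polytope.\<close>

lemma solid_angle_tendsto:
  fixes P :: "(real^'d) set"
  assumes "convex P" "closed P"
  shows "((\<lambda>r. measure lebesgue (ball x r \<inter> P) / measure lebesgue (ball x r))
           \<longlongrightarrow> solid_angle P x) (at_right 0)"
    and "x \<notin> P \<Longrightarrow> solid_angle P x = 0"
proof -
  let ?q = "\<lambda>r. measure lebesgue (ball x r \<inter> P) / measure lebesgue (ball x r)"
  \<comment> \<open>\<open>solid_angle\<close> is defined by \<open>Lim\<close>, so convergence has
    to be established before its value is known.\<close>
  have *: "solid_angle P x = l" if "(?q \<longlongrightarrow> l) (at_right 0)" for l
    unfolding solid_angle_def using that by (intro tendsto_Lim) auto
  have out: "(?q \<longlongrightarrow> 0) (at_right 0)" if x: "x \<notin> P"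
  proof -
    obtain e where e: "e > 0" "ball x e \<inter> P = {}"
      using \<open>closed P\<close> x open_contains_ball[of "- P"] by (auto simp: open_Compl disjoint_eq_subset_Compl)
    have "?q r = 0" if "0 < r" "r < e" for r
    proof -
      have "ball x r \<inter> P = {}"
        using e(2) that subset_ball[of r e x] by fastforce
      then show ?thesis by (simp only: measure_empty div_0)
    qed
    then have "eventually (\<lambda>r. ?q r = 0) (at_right 0)"
      using e(1) by (auto simp: eventually_at_right_field)
    then show ?thesis
      by (rule tendsto_eventually)
  qed
  show "x \<notin> P \<Longrightarrow> solid_angle P x = 0"
    using * out by blast
  show "(?q \<longlongrightarrow> solid_angle P x) (at_right 0)"
  proof (cases "x \<in> P")
    case False
    then show ?thesis using *[OF out] out by simp
  next
    case True
    \<comment> \<open>The contraction towards \<open>x\<close> with ratio \<open>r / t\<close> keeps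
      \<open>P\<close> inside itself by convexity and maps the larger ball onto the smaller one. It
      multiplies both volumes by the same factor.\<close>
    have mono: "?q t \<le> ?q r" if r: "0 < r" "r \<le> t" for r t
    proof -
      let ?c = "r / t" and ?d = "DIM(real^'d)"
      have t: "t > 0" and c: "0 < ?c" "?c \<le> 1" using r by auto
      have ball: "(\<lambda>y. ?c *\<^sub>R y + (1 - ?c) *\<^sub>R x) ` ball x t = ball x r"
      proof -
        have "(\<lambda>y. ?c *\<^sub>R y + (1 - ?c) *\<^sub>R x) ` ball x t = (+) ((1 - ?c) *\<^sub>R x) ` ((*\<^sub>R) ?c) ` ball x t"
          by (auto simp: image_image add.commute)
        also have "\<dots> = ball (?c *\<^sub>R x + (1 - ?c) *\<^sub>R x) (\<bar>?c\<bar> * t)"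
          using c(1) by (subst ball_scale) (simp_all only: image_add_ball less_irrefl not_False_eq_True)
        also have "\<dots> = ball x r"
          using t r(1) by (simp flip: scaleR_left_distrib)
        finally show ?thesis .
      qed
      have scale: "measure lebesgue ((\<lambda>y. ?c *\<^sub>R y + (1 - ?c) *\<^sub>R x) ` S) = ?c ^ ?d * measure lebesgue S" for S
        using measure_lebesgue_affine[of ?c "(1 - ?c) *\<^sub>R x" S] r t by simp
      have "?c ^ ?d * measure lebesgue (ball x t \<inter> P) =
          measure lebesgue ((\<lambda>y. ?c *\<^sub>R y + (1 - ?c) *\<^sub>R x) ` (ball x t \<inter> P))"
        by (rule scale[symmetric])
      also have "\<dots> \<le> measure lebesgue (ball x r \<inter> P)"
      proof (rule measure_mono_fmeasurable)
        have "?c *\<^sub>R y + (1 - ?c) *\<^sub>R x \<in> P" if "y \<in> P" for y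
          using \<open>convex P\<close> that True c by (intro convexD) auto
        then show "(\<lambda>y. ?c *\<^sub>R y + (1 - ?c) *\<^sub>R x) ` (ball x t \<inter> P) \<subseteq> ball x r \<inter> P"
          using ball by blast
        have "closed ((+) ((1 - ?c) *\<^sub>R x) ` (*\<^sub>R) ?c ` P)"
          using \<open>closed P\<close> by (intro closed_translation closed_scaling)
        then have "closed ((\<lambda>y. ?c *\<^sub>R y + (1 - ?c) *\<^sub>R x) ` P)"
          by (simp add: image_image add.commute)
        \<comment> \<open>Injectivity makes the image of the intersection the intersection of a ball
          with a closed set, hence measurable.\<close>
        moreover have "inj (\<lambda>y. ?c *\<^sub>R y + (1 - ?c) *\<^sub>R x)"
          using r t by (auto simp: inj_on_def)
        ultimately show "(\<lambda>y. ?c *\<^sub>R y + (1 - ?c) *\<^sub>R x) ` (ball x t \<inter> P) \<in> sets lebesgue"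
          by (simp only: image_Int ball) (intro sets.Int; simp)
        show "ball x r \<inter> P \<in> lmeasurable"
          using \<open>closed P\<close> by (intro fmeasurable_Int_fmeasurable) auto
      qed
      finally have le: "?c ^ ?d * measure lebesgue (ball x t \<inter> P) \<le> measure lebesgue (ball x r \<inter> P)" .
      have vol: "measure lebesgue (ball x r) = ?c ^ ?d * measure lebesgue (ball x t)"
        using scale[of "ball x t"] ball by simp
      have "?q t = (?c ^ ?d * measure lebesgue (ball x t \<inter> P)) / (?c ^ ?d * measure lebesgue (ball x t))"
        using r t by simp
      also have "\<dots> \<le> ?q r"
        unfolding vol using le c by (intro divide_right_mono) auto
      finally show ?thesis .
    qed
    \<comment> \<open>For \<open>r \<le> 0\<close> the ball is empty and the ratio is 0 / 0 = 0, so
      the bound holds for every \<open>r\<close>.\<close>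
    have bnd: "?q r \<le> 1" for r
    proof -
      have "measure lebesgue (ball x r \<inter> P) \<le> measure lebesgue (ball x r)"
        using \<open>closed P\<close> by (intro measure_mono_fmeasurable) (auto intro!: sets.Int)
      then show ?thesis
        by (simp add: divide_le_eq_1 zero_less_measure_iff not_less)
    qed
    \<comment> \<open>The ratio is negated to obtain a nondecreasing function bounded below, the
      form that \<open>Lim_right_bound\<close> expects.\<close>
    have "((\<lambda>r. - ?q r) \<longlongrightarrow> Inf ((\<lambda>r. - ?q r) ` ({0<..} \<inter> UNIV))) (at 0 within ({0<..} \<inter> UNIV))"
      using mono bnd by (intro Lim_right_bound[where K = "-1"]) auto
    then have "(?q \<longlongrightarrow> - Inf ((\<lambda>r. - ?q r) ` ({0<..} \<inter> UNIV))) (at_right 0)"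
      using tendsto_minus by fastforce
    from this *[OF this] show ?thesis by simp
  qed
qed

text \<open>Integrating over a ball of radius \<open>r\<close> and dividing by its volume gives
  exactly \<open>m\<close> for every \<open>r\<close> below 1. Letting \<open>r\<close> tend to 0 in
  this finite sum yields the identity at every point, null sets having disappeared.\<close>

lemma solid_angle_multitiling:
  fixes P :: "(real^'d) set" and m :: real
  assumes P: "compact P" "convex P"
    and tile: "AE x in lborel. (\<Sum>\<^sub>\<infinity>g\<in>affine_group. indicator P (g x) :: real) = m"
  shows "(\<Sum>w\<in>hyperoct. \<Sum>\<^sub>\<infinity>t\<in>int_lattice. solid_angle P (w x + t)) = m"
proof -
  have cl: "closed P" using P(1) by (rule compact_imp_closed)
  obtain a where a: "P \<subseteq> cball 0 a"
    using compact_imp_bounded[OF P(1)] by (auto simp: bounded_iff subset_iff)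
  \<comment> \<open>The extra 1 keeps all balls of radius below 1 around \<open>x\<close> inside
    \<open>cball 0 b\<close>, so \<open>?T\<close> does not vary with \<open>r\<close>.\<close>
  define b where "b = norm x + 1"
  let ?T = "{t \<in> (int_lattice :: (real^'d) set). norm t \<le> a + b}"
  let ?q = "\<lambda>y r. measure lebesgue (ball y r \<inter> P) / measure lebesgue (ball y r)"
  have inf: "(\<Sum>\<^sub>\<infinity>t\<in>int_lattice. solid_angle P (w x + t)) = (\<Sum>t\<in>?T. solid_angle P (w x + t))"
    if w: "w \<in> hyperoct" for w
  proof -
    have "solid_angle P (w x + t) = 0" if "\<not> norm t \<le> a + b" for t
      using hyperoct_translate_notin[OF a _ w that, of x]
      by (intro solid_angle_tendsto(2)[OF P(2) cl]) (simp add: b_def)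
    then have "(\<Sum>\<^sub>\<infinity>t\<in>int_lattice. solid_angle P (w x + t)) = (\<Sum>\<^sub>\<infinity>t\<in>?T. solid_angle P (w x + t))"
      by (intro infsum_cong_neutral) auto
    also have "\<dots> = (\<Sum>t\<in>?T. solid_angle P (w x + t))"
      by (rule infsum_finite[OF finite_lattice_bounded])
    finally show ?thesis .
  qed
  have "((\<lambda>r. \<Sum>w\<in>hyperoct. \<Sum>t\<in>?T. ?q (w x + t) r) \<longlongrightarrow>
      (\<Sum>w\<in>hyperoct. \<Sum>t\<in>?T. solid_angle P (w x + t))) (at_right 0)"
    by (intro tendsto_sum solid_angle_tendsto P cl)
  moreover have "((\<lambda>r. \<Sum>w\<in>hyperoct. \<Sum>t\<in>?T. ?q (w x + t) r) \<longlongrightarrow> m) (at_right 0)"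
  proof (rule tendsto_eventually)
    have "(\<Sum>w\<in>hyperoct. \<Sum>t\<in>?T. ?q (w x + t) r) = m" if r: "0 < r" "r < 1" for r
    proof -
      have sub: "ball x r \<subseteq> cball 0 b"
      proof
        fix y assume "y \<in> ball x r"
        then have "norm (x - y) < 1" using r by (simp add: dist_norm)
        moreover have "norm y \<le> norm x + norm (x - y)"
          by (metis norm_minus_commute norm_triangle_sub)
        ultimately show "y \<in> cball 0 b" by (simp add: b_def)
      qed
      have im: "(\<lambda>y. w y + t) ` ball x r = ball (w x + t) r" if "w \<in> hyperoct" for w t
      proof -
        have "(\<lambda>y. w y + t) ` ball x r = (+) t ` w ` ball x r"
          by (auto simp: image_image add.commute)
        then show ?thesis
          using image_orthogonal_transformation_ball[OF hyperoct_orthogonal[OF that]]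
          by simp
      qed
      have vol: "measure lebesgue (ball (w x + t) r) = measure lebesgue (ball x r)" for w and t :: "real^'d"
        using measure_translation[of "w x + t - x" "ball x r"] by simp
      have pos: "measure lebesgue (ball x r) > 0"
        using r content_ball_pos[of r x] by simp
      have "(\<Sum>w\<in>hyperoct. \<Sum>t\<in>?T. ?q (w x + t) r) =
          (\<Sum>w\<in>hyperoct. \<Sum>t\<in>?T. measure lebesgue ((\<lambda>x. w x + t) ` ball x r \<inter> P)) / measure lebesgue (ball x r)"
        unfolding sum_divide_distrib by (intro sum.cong refl) (simp only: im vol)
      also have "\<dots> = m * measure lebesgue (ball x r) / measure lebesgue (ball x r)"
        by (subst measure_multitiling[OF P(1) a _ sub tile]) simp_all
      finally show ?thesis using pos by simp
    qed
    then show "eventually (\<lambda>r. (\<Sum>w\<in>hyperoct. \<Sum>t\<in>?T. ?q (w x + t) r) = m) (at_right 0)"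
      unfolding eventually_at_right_field by (intro exI[of _ 1]) auto
  qed
  ultimately have "(\<Sum>w\<in>hyperoct. \<Sum>t\<in>?T. solid_angle P (w x + t)) = m"
    by (rule tendsto_unique[rotated]) simp
  then show ?thesis
    by (simp add: inf cong: sum.cong)
qed

section \<open>The unit cube and the multiplicity of the tiling\<close>

text \<open>Half open, so that its integer translates partition the space exactly and not just up to
  null sets.\<close>

definition unit_cube :: "(real^'d) set" where
  "unit_cube = {x. \<forall>i. 0 \<le> x $ i \<and> x $ i < 1}"

lemma unit_cube_measure:
  "(unit_cube :: (real^'d) set) \<in> sets borel" "measure lebesgue (unit_cube :: (real^'d) set) = 1"
proof -
  have sub: "box 0 1 \<subseteq> (unit_cube :: (real^'d) set)" "unit_cube \<subseteq> (cbox 0 1 :: (real^'d) set)"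
    by (auto simp: unit_cube_def mem_box_cart less_imp_le)
  have "(unit_cube :: (real^'d) set) = (\<Inter>i. {x. 0 \<le> x $ i} \<inter> {x. x $ i < 1})"
    by (auto simp: unit_cube_def)
  also have "\<dots> \<in> sets borel"
    by (intro sets.countable_INT' sets.Int borel_closed borel_open
        closed_halfspace_component_ge_cart open_halfspace_component_lt_cart) auto
  finally show Q: "(unit_cube :: (real^'d) set) \<in> sets borel" .
  then have m: "(unit_cube :: (real^'d) set) \<in> lmeasurable"
    using sub(2) by (intro fmeasurableI2[OF lmeasurable_cbox]) auto
  have one: "measure lebesgue (cbox 0 (1::real^'d)) = 1"
    by (subst measure_completion) (auto simp: content_cbox_cart interval_eq_empty_cart)
  have two: "measure lebesgue (box 0 (1::real^'d)) = 1"
    using one by (simp add: measure_def emeasure_lborel_box_eq emeasure_lborel_cbox_eq)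
  show "measure lebesgue (unit_cube :: (real^'d) set) = 1"
    using measure_mono_fmeasurable[OF sub(1) _ m] measure_mono_fmeasurable[OF sub(2) _ lmeasurable_cbox]
      one two m by auto
qed

text \<open>In each coordinate this is the splitting of a real number into its floor and its
  fractional part.\<close>

lemma unit_cube_translates:
  "\<exists>!t. t \<in> int_lattice \<and> x - t \<in> (unit_cube :: (real^'d) set)"
proof
  show "(\<chi> i. of_int \<lfloor>x $ i\<rfloor>) \<in> int_lattice \<and> x - (\<chi> i. of_int \<lfloor>x $ i\<rfloor>) \<in> unit_cube"
    by (auto simp: int_lattice_def unit_cube_def) linarith
next
  fix t assume t: "t \<in> int_lattice \<and> x - t \<in> unit_cube"
  show "t = (\<chi> i. of_int \<lfloor>x $ i\<rfloor>)"
    unfolding vec_eq_iff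
  proof
    fix i
    obtain k where k: "t $ i = of_int k"
      using t by (auto simp: int_lattice_def elim: Ints_cases)
    have "0 \<le> x $ i - t $ i" "x $ i - t $ i < 1"
      using t by (auto simp: unit_cube_def)
    then have "\<lfloor>x $ i\<rfloor> = k" unfolding k by linarith
    then show "t $ i = (\<chi> i. of_int \<lfloor>x $ i\<rfloor>) $ i" using k by simp
  qed
qed

text \<open>The integrated identity is applied to the unit cube. For each fixed \<open>w\<close> the
  translates of the moved cube cut \<open>P\<close> into disjoint pieces, so every \<open>w\<close>
  contributes the whole volume of \<open>P\<close>.\<close>

lemma multitiling_multiplicity:
  fixes P :: "(real^'d) set" and m :: real
  assumes P: "compact P"
    and tile: "AE x in lborel. (\<Sum>\<^sub>\<infinity>g\<in>affine_group. indicator P (g x) :: real) = m"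
  shows "m = real (card (hyperoct :: ((real^'d) \<Rightarrow> (real^'d)) set)) * measure lebesgue P"
proof -
  let ?Q = "unit_cube :: (real^'d) set"
  obtain a where a: "P \<subseteq> cball 0 a"
    using compact_imp_bounded[OF P] by (auto simp: bounded_iff subset_iff)
  have "bounded ?Q"
    by (rule bounded_subset[OF bounded_cbox[of 0 1]]) (auto simp: unit_cube_def mem_box_cart less_imp_le)
  then obtain b where b: "?Q \<subseteq> cball 0 b"
    by (auto simp: bounded_iff subset_iff)
  let ?T = "{t \<in> (int_lattice :: (real^'d) set). norm t \<le> a + b}"
  have "(\<Sum>t\<in>?T. measure lebesgue ((\<lambda>x. w x + t) ` ?Q \<inter> P)) = measure lebesgue P"
    if w: "w \<in> hyperoct" for w
  proof -
    let ?A = "\<lambda>t. (\<lambda>x. w x + t) ` ?Q \<inter> P"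
    have lin: "w (x - y) = w x - w y" for x y
      using hyperoct_linear[OF w] by (rule linear_diff)
    have "measure lebesgue (\<Union>t\<in>?T. ?A t) = (\<Sum>t\<in>?T. measure lebesgue (?A t))"
    proof (rule measure_UNION'[OF finite_lattice_bounded])
      fix t
      have "(\<lambda>x. w x + t) ` ?Q = (+) t ` w ` ?Q"
        by (auto simp: image_image add.commute)
      also have "\<dots> \<in> sets lebesgue"
        using hyperoct_image_borel[OF w unit_cube_measure(1)] by (intro lebesgue_sets_translation) auto
      finally show "?A t \<in> lmeasurable"
        using lmeasurable_compact[OF P] by (metis Int_commute fmeasurable_Int_fmeasurable)
    next
      show "pairwise (\<lambda>s t. disjnt (?A s) (?A t)) ?T"
      proof (rule pairwiseI, rule ccontr)
        fix s t assume "s \<in> ?T" "t \<in> ?T" and ne: "s \<noteq> t" and "\<not> disjnt (?A s) (?A t)"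
        then obtain u v where st: "s \<in> int_lattice" "t \<in> int_lattice"
          and uv: "u \<in> ?Q" "v \<in> ?Q" and eq: "w u + s = w v + t"
          by (auto simp: disjnt_iff)
        \<comment> \<open>Pulling the translations back through \<open>w\<close> reduces
          disjointness to the uniqueness of the integer translate of the standard cube.\<close>
        obtain s' t' where st': "s' \<in> int_lattice" "t' \<in> int_lattice" "w s' = s" "w t' = t"
          using hyperoct_bij_lattice[OF w] st(1,2) by (metis bij_betw_def imageE)
        have "w (u + s') = w (v + t')"
          using eq st' hyperoct_linear[OF w] by (simp add: linear_add)
        then have "u + s' = v + t'"
          using hyperoct_bij[OF w] by (simp add: bij_is_inj inj_eq)
        then have "s' = t'"
          using unit_cube_translates[of "u + s'"] st' uv by (metis add_diff_cancel_right')
        then show False using ne st' by simp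
      qed
    qed
    moreover have "(\<Union>t\<in>?T. ?A t) = P"
    proof
      show "P \<subseteq> (\<Union>t\<in>?T. ?A t)"
      proof
        fix y assume y: "y \<in> P"
        obtain y' where y': "y = w y'"
          using hyperoct_bij[OF w] by (metis bij_pointE)
        obtain t where t: "t \<in> int_lattice" "y' - t \<in> ?Q"
          using unit_cube_translates[of y'] by auto
        \<comment> \<open>As \<open>norm y' = norm y \<le> a\<close> and \<open>y' - t\<close> lies
          in the cube, the translation \<open>w t\<close> falls within the cutoff.\<close>
        have "norm t \<le> norm y' + norm (y' - t)"
          by (metis norm_minus_commute norm_triangle_sub)
        then have "norm (w t) \<le> a + b"
          using t(2) b y a hyperoct_norm[OF w] unfolding y' by force
        moreover have "w t \<in> int_lattice"
          using t(1) hyperoct_mem_lattice_iff[OF w] by simp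
        moreover have "y \<in> (\<lambda>x. w x + w t) ` ?Q"
          using t(2) by (intro image_eqI[of _ _ "y' - t"]) (simp_all add: y' lin)
        ultimately show "y \<in> (\<Union>t\<in>?T. ?A t)" using y by blast
      qed
    qed auto
    ultimately show ?thesis by simp
  qed
  then show ?thesis
    using measure_multitiling[OF P a unit_cube_measure(1) b tile]
    by (simp add: unit_cube_measure(2) cong: sum.cong)
qed

section \<open>Dilation of solid angles and elementary facts about the phases\<close>

text \<open>Dilation by \<open>c\<close> multiplies numerator and denominator by the same power of
  \<open>c\<close> and replaces the radius \<open>r / c\<close> by \<open>r\<close>, which leaves
  the limit unchanged.\<close>

lemma solid_angle_scale:
  fixes P :: "(real^'d) set"
  assumes P: "convex P" "closed P" and c: "c > 0"
  shows "solid_angle ((\<lambda>y. c *\<^sub>R y) ` P) x = solid_angle P (x /\<^sub>R c)"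
proof -
  let ?q = "\<lambda>r. measure lebesgue (ball (x /\<^sub>R c) r \<inter> P) / measure lebesgue (ball (x /\<^sub>R c) r)"
  have "filterlim (\<lambda>r. r / c) (at_right 0) (at_right 0)"
    using c filtermap_times_pos_at_right[of "inverse c" "0 :: real"]
    by (simp add: filterlim_def divide_inverse mult.commute[of _ "inverse c"])
  with solid_angle_tendsto(1)[OF P] have "((\<lambda>r. ?q (r / c)) \<longlongrightarrow> solid_angle P (x /\<^sub>R c)) (at_right 0)"
    by (rule filterlim_compose)
  moreover have "?q (r / c) = measure lebesgue (ball x r \<inter> (\<lambda>y. c *\<^sub>R y) ` P) / measure lebesgue (ball x r)" for r
  proof -
    have ball: "(\<lambda>y. c *\<^sub>R y) ` ball (x /\<^sub>R c) (r / c) = ball x r"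
      using c by (simp add: ball_scale)
    have "inj (\<lambda>y::real^'d. c *\<^sub>R y)"
      using c by (simp add: inj_on_def)
    then have "ball x r \<inter> (\<lambda>y. c *\<^sub>R y) ` P = (\<lambda>y. c *\<^sub>R y) ` (ball (x /\<^sub>R c) (r / c) \<inter> P)"
      by (simp add: image_Int ball)
    then show ?thesis
      using measure_lebesgue_affine[of c "0 :: real^'d"] c by (simp add: ball[symmetric])
  qed
  ultimately show ?thesis
    unfolding solid_angle_def by (intro tendsto_Lim) simp_all
qed

text \<open>Summability passes in both directions, backwards by taking real parts, so otherwise both
  sides take the default value 0.\<close>

lemma infsum_complex_of_real:
  fixes u :: "'a \<Rightarrow> real"
  shows "(\<Sum>\<^sub>\<infinity>x\<in>A. complex_of_real (u x)) = complex_of_real (\<Sum>\<^sub>\<infinity>x\<in>A. u x)"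
proof (rule infsum_bounded_linear_strong)
  show "(\<lambda>x. complex_of_real (u x)) summable_on A \<longleftrightarrow> u summable_on A"
    using summable_on_bounded_linear[OF bounded_linear_Re, of "\<lambda>x. complex_of_real (u x)" A]
    by (auto intro: summable_on_of_real)
qed (rule bounded_linear_of_real)

lemma ee_add: "ee (s + t) = ee s * ee t"
  by (simp add: ee_def algebra_simps exp_add)

lemma ee_int: "k \<in> \<int> \<Longrightarrow> ee k = 1"
  using exp_integer_2pi[of k] by (simp add: ee_def mult_ac)

section \<open>Residues modulo \<open>n\<close> and the power of the Gauss sum\<close>

text \<open>Representatives of the integer lattice modulo its \<open>n\<close>-fold dilate.\<close>

definition residue_box :: "nat \<Rightarrow> (real^'d) set" where
  "residue_box n = {q \<in> int_lattice. \<forall>i. 0 \<le> q $ i \<and> q $ i < real n}"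

lemma residue_box_bij:
  "bij_betw (\<lambda>h. \<chi> i. real (h i)) (\<Pi>\<^sub>E i\<in>(UNIV :: 'd set). {..<n}) (residue_box n :: (real^'d) set)"
proof (rule bij_betw_imageI)
  show "inj_on (\<lambda>h. \<chi> i. real (h i)) (\<Pi>\<^sub>E i\<in>(UNIV :: 'd set). {..<n})"
    by (auto simp: inj_on_def vec_eq_iff)
  show "(\<lambda>h. \<chi> i. real (h i)) ` (\<Pi>\<^sub>E i\<in>(UNIV :: 'd set). {..<n}) = (residue_box n :: (real^'d) set)"
  proof
    show "(residue_box n :: (real^'d) set) \<subseteq> (\<lambda>h. \<chi> i. real (h i)) ` (\<Pi>\<^sub>E i\<in>(UNIV :: 'd set). {..<n})"
    proof
      fix q :: "real^'d" assume q: "q \<in> residue_box n"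
      have k: "real (nat \<lfloor>q $ i\<rfloor>) = q $ i" for i
        using q by (auto simp: residue_box_def int_lattice_def)
      moreover have "nat \<lfloor>q $ i\<rfloor> < n" for i
        using q unfolding of_nat_less_iff[where 'a = real, symmetric] k by (simp add: residue_box_def)
      ultimately show "q \<in> (\<lambda>h. \<chi> i. real (h i)) ` (\<Pi>\<^sub>E i\<in>(UNIV :: 'd set). {..<n})"
        by (intro image_eqI[of _ _ "\<lambda>i. nat \<lfloor>q $ i\<rfloor>"]) (auto simp: vec_eq_iff)
    qed
  qed (auto simp: residue_box_def int_lattice_def PiE_def)
qed

lemma finite_residue_box: "finite (residue_box n :: (real^'d) set)"
  using bij_betw_finite[OF residue_box_bij] by (metis finite_PiE finite finite_lessThan)

text \<open>Division with remainder in every coordinate, obtained from the unit cube after dividing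
  by \<open>n\<close>.\<close>

lemma residue_box_bij_lattice:
  assumes "n > 0"
  shows "bij_betw (\<lambda>(q,t). q + real n *\<^sub>R t) (residue_box n \<times> int_lattice) (int_lattice :: (real^'d) set)"
proof -
  have scale: "q /\<^sub>R real n \<in> unit_cube" if "q \<in> residue_box n" for q :: "real^'d"
    using assms that by (auto simp: unit_cube_def residue_box_def field_simps)
  show ?thesis
  proof (rule bij_betw_imageI)
    show "inj_on (\<lambda>(q,t). q + real n *\<^sub>R t) (residue_box n \<times> (int_lattice :: (real^'d) set))"
    proof (rule inj_onI, clarify)
      fix q t q' t' :: "real^'d"
      assume q: "q \<in> residue_box n" "q' \<in> residue_box n" and t: "t \<in> int_lattice" "t' \<in> int_lattice"
        and eq: "q + real n *\<^sub>R t = q' + real n *\<^sub>R t'"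
      \<comment> \<open>Subtracting either \<open>t\<close> or \<open>t'\<close> from the same
        scaled point lands in the unit cube, so uniqueness of the translate applies.\<close>
      have "(q + real n *\<^sub>R t) /\<^sub>R real n - t = q /\<^sub>R real n"
        "(q + real n *\<^sub>R t) /\<^sub>R real n - t' = q' /\<^sub>R real n"
        using assms by (simp add: scaleR_right_distrib) (use assms in \<open>simp add: eq scaleR_right_distrib\<close>)
      then have "t = t'"
        using unit_cube_translates[of "(q + real n *\<^sub>R t) /\<^sub>R real n"] scale q t by metis
      then show "q = q' \<and> t = t'" using eq by simp
    qed
    show "(\<lambda>(q,t). q + real n *\<^sub>R t) ` (residue_box n \<times> int_lattice) = (int_lattice :: (real^'d) set)"
    proof
      show "int_lattice \<subseteq> (\<lambda>(q,t). q + real n *\<^sub>R t) ` (residue_box n \<times> (int_lattice :: (real^'d) set))"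
      proof
        fix x :: "real^'d" assume x: "x \<in> int_lattice"
        obtain t where t: "t \<in> int_lattice" "x /\<^sub>R real n - t \<in> unit_cube"
          using unit_cube_translates[of "x /\<^sub>R real n"] by auto
        have "x - real n *\<^sub>R t \<in> residue_box n"
          using t assms int_lattice_diff[OF x int_lattice_scaleR[OF t(1)]]
          by (auto simp: residue_box_def unit_cube_def field_simps)
        then show "x \<in> (\<lambda>(q,t). q + real n *\<^sub>R t) ` (residue_box n \<times> (int_lattice :: (real^'d) set))"
          using t(1) by (intro image_eqI[of _ _ "(x - real n *\<^sub>R t, t)"]) auto
      qed
    qed (auto simp: residue_box_def int_lattice_add int_lattice_scaleR)
  qed
qed

text \<open>Expanding the product of sums gives one term per residue vector, and \<open>ee\<close>
  turns the sum of squared coordinates into a product.\<close>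

lemma gauss_sum_power:
  "gauss_sum n ^ CARD('d) = (\<Sum>q\<in>(residue_box n :: (real^'d) set). ee ((norm q)\<^sup>2 / real n))"
proof -
  have prod: "ee (\<Sum>i\<in>A. f i) = (\<Prod>i\<in>A. ee (f i))" if "finite A" for A and f :: "'d \<Rightarrow> real"
    using that by induction (auto simp: ee_add ee_int)
  have "gauss_sum n ^ CARD('d) = (\<Prod>i\<in>(UNIV :: 'd set). \<Sum>k<n. ee (real (k\<^sup>2) / real n))"
    by (simp add: gauss_sum_def)
  also have "\<dots> = (\<Sum>h\<in>(\<Pi>\<^sub>E i\<in>(UNIV :: 'd set). {..<n}). \<Prod>i\<in>UNIV. ee (real ((h i)\<^sup>2) / real n))"
    by (rule prod_sum_PiE) auto
  also have "\<dots> = (\<Sum>h\<in>(\<Pi>\<^sub>E i\<in>(UNIV :: 'd set). {..<n}). ee ((norm (\<chi> i. real (h i) :: real^'d))\<^sup>2 / real n))"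
    by (simp add: prod[symmetric] norm_vec_def L2_set_def sum_nonneg sum_divide_distrib)
  also have "\<dots> = (\<Sum>q\<in>(residue_box n :: (real^'d) set). ee ((norm q)\<^sup>2 / real n))"
    by (rule sum.reindex_bij_betw[OF residue_box_bij])
  finally show ?thesis .
qed

text \<open>After expanding the squared norm and dividing by \<open>n\<close>, the terms involving
  \<open>t\<close> are integers.\<close>

lemma ee_norm_periodic:
  fixes q t :: "real^'d"
  assumes "n > 0" "q \<in> int_lattice" "t \<in> int_lattice"
  shows "ee ((norm (q + real n *\<^sub>R t))\<^sup>2 / real n) = ee ((norm q)\<^sup>2 / real n)"
proof -
  have inner: "x \<bullet> y \<in> \<int>" if "x \<in> int_lattice" "y \<in> int_lattice" for x y :: "real^'d"
    using that by (auto simp: inner_vec_def int_lattice_def)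
  have "(norm (q + real n *\<^sub>R t))\<^sup>2 / real n =
      (norm q)\<^sup>2 / real n + (2 * (q \<bullet> t) + real n * (t \<bullet> t))"
    using assms(1)
    by (simp add: power2_norm_eq_inner inner_add_left inner_add_right inner_commute field_simps)
  moreover have "2 * (q \<bullet> t) + real n * (t \<bullet> t) \<in> \<int>"
    using inner assms by auto
  ultimately show ?thesis
    by (simp only: ee_add[of "(norm q)\<^sup>2 / real n"] ee_int mult_1_right)
qed

section \<open>Averaging the polyhedral Gauss sum over the hyperoctahedral group\<close>

theorem theorem1:
  fixes P :: "(real^'d) set" and n :: nat
  assumes "polytope P"
    and "\<forall>v. v extreme_point_of P \<longrightarrow> v \<in> int_lattice"
    and "\<exists>m::int. AE x in lborel.
           (\<Sum>\<^sub>\<infinity>g\<in>affine_group. indicator P (g x) :: real) = real_of_int m"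
    and "n > 0"
  shows "poly_gauss_sum P n = complex_of_real (measure lebesgue P) * gauss_sum n ^ CARD('d)"
proof -
  obtain m :: real where
    tile: "AE x in lborel. (\<Sum>\<^sub>\<infinity>g\<in>affine_group. indicator P (g x) :: real) = m"
    using assms(3) by blast
  have P: "compact P" "convex P" "closed P"
    using assms(1) polytope_imp_compact polytope_imp_convex polytope_imp_closed by auto
  obtain a where a: "P \<subseteq> cball 0 a"
    using compact_imp_bounded[OF P(1)] by (auto simp: bounded_iff subset_iff)
  let ?W = "hyperoct :: ((real^'d) \<Rightarrow> (real^'d)) set" and ?L = "int_lattice :: (real^'d) set"
  define f :: "real^'d \<Rightarrow> complex" where "f x = ee ((norm x)\<^sup>2 / real n)" for x
  define h :: "real^'d \<Rightarrow> complex" where "h x = of_real (solid_angle P (x /\<^sub>R real n)) * f x" for x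
  have n: "real n > 0" using assms(4) by simp
  have gp: "poly_gauss_sum P n = infsum h ?L"
    unfolding poly_gauss_sum_def h_def f_def using solid_angle_scale[OF P(2,3) n] by simp
  have h_support: "h x = 0" if "\<not> norm x \<le> real n * a" for x
  proof -
    have "x /\<^sub>R real n \<notin> P"
      using a that n by (auto simp: field_simps)
    then show ?thesis
      using solid_angle_tendsto(2)[OF P(2,3)] by (simp add: h_def)
  qed
  have "h summable_on {x \<in> ?L. norm x \<le> real n * a}"
    by (rule summable_on_finite[OF finite_lattice_bounded])
  then have h_summable: "h summable_on ?L"
    by (rule summable_on_cong_neutral[THEN iffD1, rotated -1]) (use h_support in auto)
  \<comment> \<open>Each lattice point is written as \<open>w (q + n t)\<close>. The phase then
    depends on \<open>q\<close> alone, and the remaining sum over \<open>t\<close> is the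
    \<open>w\<close>-part of the tiling identity at the point \<open>q / n\<close>.\<close>
  have unfolded: "infsum h ?L = (\<Sum>q\<in>residue_box n. f q * of_real (\<Sum>\<^sub>\<infinity>t\<in>?L. solid_angle P (w (q /\<^sub>R real n) + t)))"
    if w: "w \<in> ?W" for w
  proof -
    let ?k = "\<lambda>(q,t). h (w (q + real n *\<^sub>R t))"
    have bij: "bij_betw (\<lambda>(q,t). w (q + real n *\<^sub>R t)) (residue_box n \<times> ?L) ?L"
      using bij_betw_trans[OF residue_box_bij_lattice[OF assms(4)] hyperoct_bij_lattice[OF w]]
      by (simp add: o_def case_prod_unfold)
    have "?k summable_on residue_box n \<times> ?L"
      using h_summable summable_on_reindex_bij_betw[OF bij, of h] by (simp add: case_prod_unfold)
    then have "infsum ?k (residue_box n \<times> ?L) =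
        (\<Sum>\<^sub>\<infinity>q\<in>residue_box n. \<Sum>\<^sub>\<infinity>t\<in>?L. h (w (q + real n *\<^sub>R t)))"
      by (subst infsum_Sigma'_banach[symmetric]) auto
    moreover have "infsum ?k (residue_box n \<times> ?L) = infsum h ?L"
      using infsum_reindex_bij_betw[OF bij, of h] by (simp add: case_prod_unfold)
    moreover have "(\<Sum>\<^sub>\<infinity>t\<in>?L. h (w (q + real n *\<^sub>R t))) =
        f q * of_real (\<Sum>\<^sub>\<infinity>t\<in>?L. solid_angle P (w (q /\<^sub>R real n) + t))"
      if q: "q \<in> residue_box n" for q
    proof -
      have "h (w (q + real n *\<^sub>R t)) = f q * of_real (solid_angle P (w (q /\<^sub>R real n) + w t))"
        if "t \<in> ?L" for t
      proof -
        have "f (w (q + real n *\<^sub>R t)) = f q"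
          using ee_norm_periodic[OF assms(4) _ that, of q] q
          by (simp add: f_def hyperoct_norm[OF w] residue_box_def)
        moreover have "w (q + real n *\<^sub>R t) /\<^sub>R real n = w (q /\<^sub>R real n) + w t"
          using hyperoct_linear[OF w] n
          by (simp add: linear_add linear_cmul scaleR_right_distrib)
        ultimately show ?thesis by (simp add: h_def)
      qed
      then have "(\<Sum>\<^sub>\<infinity>t\<in>?L. h (w (q + real n *\<^sub>R t))) =
          (\<Sum>\<^sub>\<infinity>t\<in>?L. f q * of_real (solid_angle P (w (q /\<^sub>R real n) + w t)))"
        by (intro infsum_cong) auto
      \<comment> \<open>As \<open>w\<close> permutes the lattice, \<open>w t\<close> may be renamed
        to \<open>t\<close>.\<close>
      also have "\<dots> = (\<Sum>\<^sub>\<infinity>t\<in>?L. f q * of_real (solid_angle P (w (q /\<^sub>R real n) + t)))"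
        by (rule infsum_reindex_bij_betw[OF hyperoct_bij_lattice[OF w]])
      also have "\<dots> = f q * of_real (\<Sum>\<^sub>\<infinity>t\<in>?L. solid_angle P (w (q /\<^sub>R real n) + t))"
        by (simp add: infsum_cmult_right' infsum_complex_of_real)
      finally show ?thesis .
    qed
    ultimately show ?thesis
      by (simp add: finite_residue_box cong: sum.cong)
  qed
  \<comment> \<open>The left side of \<open>unfolded\<close> does not depend on \<open>w\<close>;
    summing over all \<open>w\<close> completes the inner sums to the full tiling sum, which equals
    \<open>m\<close> for every \<open>q\<close>.\<close>
  have "of_nat (card ?W) * infsum h ?L = (\<Sum>w\<in>?W. infsum h ?L)"
    by simp
  also have "\<dots> = (\<Sum>w\<in>?W. \<Sum>q\<in>residue_box n. f q * of_real (\<Sum>\<^sub>\<infinity>t\<in>?L. solid_angle P (w (q /\<^sub>R real n) + t)))"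
    by (rule sum.cong[OF refl unfolded])
  also have "\<dots> = (\<Sum>q\<in>residue_box n. f q * of_real (\<Sum>w\<in>?W. \<Sum>\<^sub>\<infinity>t\<in>?L. solid_angle P (w (q /\<^sub>R real n) + t)))"
    by (subst sum.swap) (simp add: sum_distrib_left)
  also have "\<dots> = of_real m * gauss_sum n ^ CARD('d)"
    by (simp add: solid_angle_multitiling[OF P(1,2) tile] gauss_sum_power f_def sum_distrib_right mult.commute
        flip: sum_distrib_left)
  also have "\<dots> = of_nat (card ?W) * (of_real (measure lebesgue P) * gauss_sum n ^ CARD('d))"
    by (simp add: multitiling_multiplicity[OF P(1) tile])
  finally have "of_nat (card ?W) * infsum h ?L =
      of_nat (card ?W) * (of_real (measure lebesgue P) * gauss_sum n ^ CARD('d))" .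
  \<comment> \<open>The group contains the identity, so its order can be cancelled.\<close>
  moreover have "card ?W \<noteq> 0"
    using finite_hyperoct id_in_hyperoct by (metis card_0_eq empty_iff)
  ultimately show ?thesis
    by (simp add: gp)
qed

end
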